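(* For all $p,q,r\ge 0$ with $n=p+q+r\ge 1$, the group $\mathrm{P}^{\pm\mathrm{rad}}_{p,q,r}$ has the following equivalent definitions: $$\mathrm{P}^{\pm\mathrm{rad}}_{p,q,r}=(\mathcal{G}^{(0)\times}_{p,q,r}\cup\mathcal{G}^{(1)\times}_{p,q,r})\,(\mathcal{G}^{0}\oplus\mathrm{rad}\,\mathcal{G}_{p,q,r})^{\times}=\{T\in\mathcal{G}^{\times}_{p,q,r}:\ \widehat{T^{-1}}\,T\in(\mathcal{G}^{0}\oplus\mathrm{rad}\,\mathcal{G}_{p,q,r})^{\times}\}.$$
   Context: Let $\mathbb{F}=\mathbb{R}$ or $\mathbb{F}=\mathbb{C}$, let $p,q,r\ge 0$ be integers and $n=p+q+r\ge 1$. $\mathcal{G}_{p,q,r}$ denotes the (Clifford) geometric algebra: the unital associative $\mathbb{F}$-algebra of dimension $2^n$ with identity $e$ and generators $e_1,\dots,e_n$ satisfying $e_ae_b+e_be_a=2\eta_{ab}e$, where $\eta$ is the diagonal matrix whose diagonal is $p$ times $1$, then $q$ times $-1$, then $r$ times $0$ (if $\mathbb{F}=\mathbb{R}$), or $p+q$ times $1$, then $r$ times $0$ (if $\mathbb{F}=\mathbb{C}$). A basis is given by $e_{a_1\ldots a_k}:=e_{a_1}\cdots e_{a_k}$, $a_1<\dots<a_k$, $0\le k\le n$ (the empty product being $e$); $\mathcal{G}^k_{p,q,r}$ (grade $k$) is the span of those with $k$ indices, and $\mathcal{G}^0=\mathbb{F}e$. The grade involution $U\mapsto\widehat U$ is the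 algebra automorphism with $\widehat{e_a}=-e_a$. $\mathcal{G}^{(k)}_{p,q,r}=\{U:\widehat U=(-1)^kU\}=\bigoplus_{j\equiv k \bmod 2}\mathcal{G}^j_{p,q,r}$, $k=0,1$ (even and odd subspaces). $\mathrm{rad}\,\mathcal{G}_{p,q,r}$ is the Jacobson radical of $\mathcal{G}_{p,q,r}$; it is the span of the basis elements $e_{a_1\ldots a_k}$ containing at least one index from $\{p+q+1,\dots,n\}$ (it is $\{0\}$ if $r=0$). For a subset $A\subseteq\mathcal{G}_{p,q,r}$, $A^\times$ denotes the set of elements of $A$ invertible in $\mathcal{G}_{p,q,r}$ (e.g. $\mathcal{G}^{(0)\times}_{p,q,r}$ for $A=\mathcal{G}^{(0)}_{p,q,r}$). A product of subsets is the set of products of their elements. The group $\mathrm{P}^{\pm\mathrm{rad}}_{p,q,r}$ is defined as $\mathrm{P}^{\pm}_{p,q,r}(\mathcal{G}^{0}\oplus\mathrm{rad}\,\mathcal{G}_{p,q,r})^{\times}$, where $\mathrm{P}^{\pm}_{p,q,r}:=\mathcal{G}^{(0)\times}_{p,q,r}\cup\mathcal{G}^{(1)\times}_{p,q,r}$. *)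

theory Defs
  imports Complex_Main "HOL-Library.Set_Algebras"
begin

text \<open>
  Sums and products of subsets are those of \<^theory>\<open>HOL-Library.Set_Algebras\<close>:
  \<open>A + B\<close> and \<open>A * B\<close> consist of all \<open>a + b\<close>, respectively \<open>a * b\<close>, with
  \<open>a \<in> A\<close> and \<open>b \<in> B\<close>.
\<close>

definition is_inverse_of :: "'a::ring_1 \<Rightarrow> 'a \<Rightarrow> bool"
  where "is_inverse_of V U \<longleftrightarrow> U * V = 1 \<and> V * U = 1"

definition invertibles :: "'a::ring_1 set \<Rightarrow> 'a set"  (\<open>_\<^sup>\<times>\<close> [1000] 1000)
  where "A\<^sup>\<times> = {U \<in> A. \<exists>V. is_inverse_of V U}"

text \<open>Meaningful only for invertible arguments.\<close>

definition ring_inverse :: "'a::ring_1 \<Rightarrow> 'a"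
  where "ring_inverse U = (THE V. is_inverse_of V U)"

definition left_ideal :: "'a::ring_1 set \<Rightarrow> bool"
  where "left_ideal I \<longleftrightarrow>
    0 \<in> I \<and> (\<forall>x\<in>I. \<forall>y\<in>I. x + y \<in> I) \<and> (\<forall>x. \<forall>y\<in>I. x * y \<in> I)"

definition maximal_left_ideal :: "'a::ring_1 set \<Rightarrow> bool"
  where "maximal_left_ideal I \<longleftrightarrow>
    left_ideal I \<and> I \<noteq> UNIV \<and> (\<forall>J. left_ideal J \<and> I \<subseteq> J \<longrightarrow> J = I \<or> J = UNIV)"

definition jacobson_radical :: "'a::ring_1 set"
  where "jacobson_radical = \<Inter> {I. maximal_left_ideal I}"

locale unital_algebra = vector_space scale
  for scale :: "'f::field \<Rightarrow> 'a::ring_1 \<Rightarrow> 'a" +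
  assumes scale_mult_left: "scale c x * y = scale c (x * y)"
    and scale_mult_right: "x * scale c y = scale c (x * y)"

definition subalgebra :: "('f::field \<Rightarrow> 'a::ring_1 \<Rightarrow> 'a) \<Rightarrow> 'a set \<Rightarrow> bool"
  where "subalgebra scale S \<longleftrightarrow>
    module.subspace scale S \<and> 1 \<in> S \<and> (\<forall>x\<in>S. \<forall>y\<in>S. x * y \<in> S)"

definition algebra_automorphism ::
    "('f::field \<Rightarrow> 'a::ring_1 \<Rightarrow> 'a) \<Rightarrow> ('a \<Rightarrow> 'a) \<Rightarrow> bool"
  where "algebra_automorphism scale \<phi> \<longleftrightarrow>
    bij \<phi> \<and> Vector_Spaces.linear scale scale \<phi> \<and> \<phi> 1 = 1 \<and> (\<forall>x y. \<phi> (x * y) = \<phi> x * \<phi> y)"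

text \<open>
  The algebra is the whole type \<open>'a\<close>; the generators are \<open>gen 1, \<dots>, gen n\<close>, and the values of
  \<open>gen\<close> and \<open>\<eta>\<close> at other indices play no role.  The conditions determine the algebra up to
  isomorphism, and they make the ordered products of distinct generators a basis.
\<close>

locale clifford_algebra = unital_algebra scale
  for scale :: "'f::field \<Rightarrow> 'a::ring_1 \<Rightarrow> 'a" +
  fixes gen :: "nat \<Rightarrow> 'a" and n :: nat and \<eta> :: "nat \<Rightarrow> nat \<Rightarrow> 'f"
  assumes relations: "\<lbrakk>a \<in> {1..n}; b \<in> {1..n}\<rbrakk> \<Longrightarrow>
      gen a * gen b + gen b * gen a = scale (2 * \<eta> a b) 1"
    and generated: "\<lbrakk>subalgebra scale S; gen ` {1..n} \<subseteq> S\<rbrakk> \<Longrightarrow> S = UNIV"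
    and dimension: "dim (UNIV :: 'a set) = 2 ^ n"

definition real_metric :: "nat \<Rightarrow> nat \<Rightarrow> nat \<Rightarrow> nat \<Rightarrow> real"
  where "real_metric p q a b =
    (if a \<noteq> b then 0 else if a \<le> p then 1 else if a \<le> p + q then -1 else 0)"

definition complex_metric :: "nat \<Rightarrow> nat \<Rightarrow> nat \<Rightarrow> nat \<Rightarrow> complex"
  where "complex_metric p q a b = (if a \<noteq> b then 0 else if a \<le> p + q then 1 else 0)"

definition real_geometric_algebra ::
    "nat \<Rightarrow> nat \<Rightarrow> nat \<Rightarrow> (real \<Rightarrow> 'a::ring_1 \<Rightarrow> 'a) \<Rightarrow> (nat \<Rightarrow> 'a) \<Rightarrow> bool"
  where "real_geometric_algebra p q r scale gen \<longleftrightarrow>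
    clifford_algebra scale gen (p + q + r) (real_metric p q)"

definition complex_geometric_algebra ::
    "nat \<Rightarrow> nat \<Rightarrow> nat \<Rightarrow> (complex \<Rightarrow> 'a::ring_1 \<Rightarrow> 'a) \<Rightarrow> (nat \<Rightarrow> 'a) \<Rightarrow> bool"
  where "complex_geometric_algebra p q r scale gen \<longleftrightarrow>
    clifford_algebra scale gen (p + q + r) (complex_metric p q)"

definition grade_involution ::
    "('f::field \<Rightarrow> 'a::ring_1 \<Rightarrow> 'a) \<Rightarrow> (nat \<Rightarrow> 'a) \<Rightarrow> nat \<Rightarrow> 'a \<Rightarrow> 'a"
  where "grade_involution scale gen n =
    (THE \<phi>. algebra_automorphism scale \<phi> \<and> (\<forall>a\<in>{1..n}. \<phi> (gen a) = - gen a))"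

text \<open>The even (\<open>k = 0\<close>) and odd (\<open>k = 1\<close>) subspaces.\<close>

definition parity_subspace ::
    "('f::field \<Rightarrow> 'a::ring_1 \<Rightarrow> 'a) \<Rightarrow> (nat \<Rightarrow> 'a) \<Rightarrow> nat \<Rightarrow> nat \<Rightarrow> 'a set"
  where "parity_subspace scale gen n k =
    {U. grade_involution scale gen n U = scale ((-1) ^ k) U}"

definition grade0 :: "('f::field \<Rightarrow> 'a::ring_1 \<Rightarrow> 'a) \<Rightarrow> 'a set"
  where "grade0 scale = range (\<lambda>c. scale c 1)"

definition P_pm ::
    "('f::field \<Rightarrow> 'a::ring_1 \<Rightarrow> 'a) \<Rightarrow> (nat \<Rightarrow> 'a) \<Rightarrow> nat \<Rightarrow> 'a set"
  where "P_pm scale gen n =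
    (parity_subspace scale gen n 0)\<^sup>\<times> \<union> (parity_subspace scale gen n 1)\<^sup>\<times>"

definition P_pm_rad ::
    "('f::field \<Rightarrow> 'a::ring_1 \<Rightarrow> 'a) \<Rightarrow> (nat \<Rightarrow> 'a) \<Rightarrow> nat \<Rightarrow> 'a set"
  where "P_pm_rad scale gen n = P_pm scale gen n * (grade0 scale + jacobson_radical)\<^sup>\<times>"

end

theory Submission
  imports Defs
begin

text \<open>
  Write \<open>\<phi>\<close> for the grade involution and \<open>J\<close> for the Jacobson radical, a proper two-sided ideal
  stable under automorphisms.  If \<open>\<phi> T\<^sup>-\<^sup>1 * T = c + x\<close> with \<open>x \<in> J\<close>, comparing parities in
  \<open>T = \<phi> T * (c + x)\<close> modulo \<open>J\<close> shows that the even or the odd part of \<open>T\<close> lies in \<open>J\<close>; the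
  other part is then a unit \<open>U\<close>, and \<open>T \<in> U * (1 + J)\<close>.  The existence of \<open>\<phi>\<close> rests on
  the dimension hypothesis, which makes the ordered products of generators a basis.
\<close>

subsection \<open>Inverses and the Jacobson radical\<close>

lemma ring_inverse_eq:
  assumes "is_inverse_of V U"
  shows "ring_inverse U = V"
  unfolding ring_inverse_def
proof (rule the_equality)
  fix W assume "is_inverse_of W U"
  then have "W = W * (U * V)" using assms by (simp add: is_inverse_of_def)
  also have "\<dots> = V" using \<open>is_inverse_of W U\<close>
    by (simp add: is_inverse_of_def flip: mult.assoc)
  finally show "W = V" .
qed (rule assms)

lemma is_inverse_of_sym: "is_inverse_of V U \<Longrightarrow> is_inverse_of U V"
  by (simp add: is_inverse_of_def)

lemma is_inverse_of_mult:
  assumes "is_inverse_of V U" and "is_inverse_of V' U'"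
  shows "is_inverse_of (V' * V) (U * U')"
proof -
  have "U * U' * (V' * V) = U * (U' * V') * V" "V' * V * (U * U') = V' * (V * U) * U'"
    by (simp_all add: mult.assoc)
  with assms show ?thesis by (simp add: is_inverse_of_def)
qed

section \<open>Left ideals and the existence of maximal ones\<close>

lemma left_ideal_zero: "left_ideal I \<Longrightarrow> 0 \<in> I"
  and left_ideal_add: "\<lbrakk>left_ideal I; x \<in> I; y \<in> I\<rbrakk> \<Longrightarrow> x + y \<in> I"
  and left_ideal_mult: "\<lbrakk>left_ideal I; y \<in> I\<rbrakk> \<Longrightarrow> x * y \<in> I"
  by (auto simp: left_ideal_def)

lemma left_ideal_diff: "\<lbrakk>left_ideal I; x \<in> I; y \<in> I\<rbrakk> \<Longrightarrow> x - y \<in> I"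
  using left_ideal_add[of I x "-1 * y"] left_ideal_mult[of I y "-1"] by simp

lemma left_ideal_UNIV_iff:
  assumes "left_ideal I"
  shows "I = UNIV \<longleftrightarrow> 1 \<in> I"
  using left_ideal_mult[OF assms, of 1] by auto

text \<open>Zorn's lemma for the left ideals above \<open>I\<close> that omit 1. Properness is
  expressed as omitting 1 because that condition passes to unions of chains.\<close>

lemma left_ideal_in_maximal:
  assumes I: "left_ideal I" and "1 \<notin> I"
  obtains M where "maximal_left_ideal M" and "I \<subseteq> M"
proof -
  let ?A = "{J. left_ideal J \<and> I \<subseteq> J \<and> 1 \<notin> J}"
  have "\<exists>M\<in>?A. \<forall>X\<in>?A. M \<subseteq> X \<longrightarrow> X = M"
  proof (rule subset_Zorn_nonempty)
    show "?A \<noteq> {}" using assms by auto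
  next
    fix C assume ne: "C \<noteq> {}" and ch: "subset.chain ?A C"
    then have C: "\<And>J. J \<in> C \<Longrightarrow> left_ideal J \<and> I \<subseteq> J \<and> 1 \<notin> J"
      by (auto simp: subset.chain_def)
    have "x + y \<in> \<Union>C" if "x \<in> \<Union>C" "y \<in> \<Union>C" for x y
    proof -
      from that obtain J K where "J \<in> C" "K \<in> C" "x \<in> J" "y \<in> K" by auto
      moreover from this ch have "J \<subseteq> K \<or> K \<subseteq> J" by (auto simp: subset_chain_def)
      ultimately have "\<exists>L\<in>C. x \<in> L \<and> y \<in> L" by auto
      then show ?thesis using C left_ideal_add by blast
    qed
    moreover have "x * y \<in> \<Union>C" if "y \<in> \<Union>C" for x y
      using that C left_ideal_mult by blast
    moreover have "0 \<in> \<Union>C" using ne C left_ideal_zero by blast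
    ultimately have "left_ideal (\<Union>C)" by (simp only: left_ideal_def) blast
    moreover have "I \<subseteq> \<Union>C" "1 \<notin> \<Union>C" using ne C by blast+
    ultimately show "\<Union>C \<in> ?A" by simp
  qed
  then obtain M where M: "left_ideal M" "I \<subseteq> M" "1 \<notin> M"
    and max: "\<And>J. left_ideal J \<Longrightarrow> M \<subseteq> J \<Longrightarrow> 1 \<notin> J \<Longrightarrow> J = M"
    by (auto dest: order.trans)
  have "maximal_left_ideal M"
    unfolding maximal_left_ideal_def using M max left_ideal_UNIV_iff by auto
  with M that show thesis by blast
qed

section \<open>The Jacobson radical: properness, two-sidedness, and units
  \<open>1 + x\<close>\<close>

lemma left_ideal_jacobson_radical: "left_ideal (jacobson_radical :: 'a::ring_1 set)"
  unfolding jacobson_radical_def maximal_left_ideal_def left_ideal_def by auto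

text \<open>At least one maximal left ideal must exist, since otherwise the intersection would be
  the whole ring. One is found above the zero ideal, which omits 1 because the ring is
  nontrivial.\<close>

lemma one_not_in_jacobson_radical: "1 \<notin> (jacobson_radical :: 'a::ring_1 set)"
proof -
  have "left_ideal {0 :: 'a}" by (simp add: left_ideal_def)
  then obtain M :: "'a set" where "maximal_left_ideal M"
    by (rule left_ideal_in_maximal) auto
  then show ?thesis
    using left_ideal_UNIV_iff unfolding jacobson_radical_def maximal_left_ideal_def by auto
qed

text \<open>For \<open>r \<notin> M\<close> right multiplication by \<open>r\<close> induces an isomorphism of the left modules
  \<open>R / {s. s * r \<in> M}\<close> and \<open>R / M\<close>, and the latter is simple.\<close>

lemma maximal_left_ideal_right_translate:
  assumes M: "maximal_left_ideal M" and r: "r \<notin> M"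
  shows "maximal_left_ideal {s. s * r \<in> M}" (is "maximal_left_ideal ?N")
proof -
  have lM: "left_ideal M" using M by (simp add: maximal_left_ideal_def)
  have lN: "left_ideal ?N" using lM by (auto simp: left_ideal_def distrib_right mult.assoc)
  have "J = ?N \<or> J = UNIV" if J: "left_ideal J" and NJ: "?N \<subseteq> J" for J
  proof (cases "J \<subseteq> ?N")
    case False
    then obtain s where s: "s \<in> J" "s * r \<notin> M" by auto
    \<comment> \<open>This is \<open>M + R (s r)\<close>, a left ideal strictly above
      \<open>M\<close>, hence everything. Writing \<open>r\<close> in this form puts
      \<open>(1 - t s) r\<close> in \<open>M\<close>, so \<open>1 - t s\<close> lies in
      \<open>J\<close>; since \<open>s\<close> does too, so does 1.\<close>
    let ?K = "{m + t * (s * r) |m t. m \<in> M}"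
    have lK: "left_ideal ?K"
      unfolding left_ideal_def
    proof (intro conjI ballI allI)
      show "0 \<in> ?K"
        using left_ideal_zero[OF lM] by (auto intro!: exI[of _ 0])
    next
      fix x y assume "x \<in> ?K" "y \<in> ?K"
      then obtain m t m' t' where "x = m + t * (s * r)" "y = m' + t' * (s * r)" "m \<in> M" "m' \<in> M"
        by auto
      then have "x + y = (m + m') + (t + t') * (s * r)" "m + m' \<in> M"
        using left_ideal_add[OF lM] by (auto simp: distrib_right)
      then show "x + y \<in> ?K" by blast
    next
      fix x y assume "y \<in> ?K"
      then obtain m t where "y = m + t * (s * r)" "m \<in> M" by auto
      then have "x * y = x * m + (x * t) * (s * r)" "x * m \<in> M"
        using left_ideal_mult[OF lM] by (auto simp: distrib_left mult.assoc)
      then show "x * y \<in> ?K" by blast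
    qed
    have MK: "M \<subseteq> ?K"
    proof
      fix m assume "m \<in> M"
      moreover have "m = m + 0 * (s * r)" by simp
      ultimately show "m \<in> ?K" by blast
    qed
    have "s * r = 0 + 1 * (s * r)" by simp
    then have "s * r \<in> ?K" using left_ideal_zero[OF lM] by blast
    with s lK MK M have "?K = UNIV" unfolding maximal_left_ideal_def by blast
    then obtain m t where "r = m + t * (s * r)" "m \<in> M" by blast
    then have "(1 - t * s) * r \<in> M" by (simp add: left_diff_distrib mult.assoc) (metis add_diff_cancel_right')
    with NJ have "1 - t * s \<in> J" by auto
    moreover have "t * s \<in> J" using left_ideal_mult[OF J] s by auto
    ultimately have "1 \<in> J" using left_ideal_add[OF J] by force
    with J show ?thesis by (simp add: left_ideal_UNIV_iff)
  qed (use NJ in auto)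
  with lN r show ?thesis by (auto simp: maximal_left_ideal_def left_ideal_UNIV_iff)
qed

text \<open>The intersection of left ideals is only visibly a left ideal. For \<open>r\<close>
  outside \<open>M\<close>, the translate of \<open>M\<close> by \<open>r\<close> is again maximal,
  so it contains \<open>x\<close>, which says that \<open>x r\<close> is in
  \<open>M\<close>.\<close>

lemma jacobson_radical_mult_right:
  assumes x: "x \<in> jacobson_radical"
  shows "x * r \<in> jacobson_radical"
  unfolding jacobson_radical_def
proof clarify
  fix M :: "'a set" assume M: "maximal_left_ideal M"
  show "x * r \<in> M"
  proof (cases "r \<in> M")
    case True
    with M show ?thesis by (simp add: maximal_left_ideal_def left_ideal_mult)
  next
    case False
    from maximal_left_ideal_right_translate[OF M this] x show ?thesis
      by (auto simp: jacobson_radical_def)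
  qed
qed

text \<open>If the left ideal generated by \<open>1 + x\<close> were proper, a maximal left ideal
  above it would contain both \<open>1 + x\<close> and \<open>x\<close>, hence 1.\<close>

lemma jacobson_radical_left_inverse:
  fixes x :: "'a::ring_1"
  assumes "x \<in> jacobson_radical"
  shows "\<exists>v. v * (1 + x) = 1"
proof (rule ccontr)
  assume no: "\<nexists>v. v * (1 + x) = 1"
  let ?I = "range (\<lambda>v. v * (1 + x))"
  have "left_ideal ?I"
    unfolding left_ideal_def
  proof (intro conjI ballI allI)
    show "0 \<in> ?I" by (rule range_eqI[of _ _ 0]) simp
    show "y + z \<in> ?I" if "y \<in> ?I" "z \<in> ?I" for y z
      using that by (auto simp flip: distrib_right)
    show "y * z \<in> ?I" if "z \<in> ?I" for y z
      using that by (auto simp flip: mult.assoc)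
  qed
  moreover have "1 \<notin> ?I" using no by (metis imageE)
  ultimately obtain M where M: "maximal_left_ideal M" "?I \<subseteq> M"
    by (rule left_ideal_in_maximal)
  have "1 + x \<in> M" using M by (metis mult_1 rangeI subsetD)
  moreover have "x \<in> M" using assms M by (simp add: jacobson_radical_def)
  ultimately have "1 \<in> M"
    using left_ideal_diff[of M "1 + x" x] M by (simp add: maximal_left_ideal_def)
  with M(1) left_ideal_UNIV_iff show False unfolding maximal_left_ideal_def by blast
qed

text \<open>A left inverse \<open>v\<close> of \<open>1 + x\<close> is \<open>1 - v * x\<close>, so it has itself a left inverse.\<close>

lemma jacobson_radical_invertible:
  fixes x :: "'a::ring_1"
  assumes "x \<in> jacobson_radical"
  shows "\<exists>v. is_inverse_of v (1 + x)"
proof -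
  obtain v where v: "v * (1 + x) = 1" using jacobson_radical_left_inverse[OF assms] by auto
  have "(- v) * x \<in> jacobson_radical"
    using assms left_ideal_jacobson_radical left_ideal_mult by blast
  then obtain w where "w * (1 + (- v) * x) = 1" using jacobson_radical_left_inverse by blast
  moreover have "1 + (- v) * x = v" using v by (simp add: distrib_left algebra_simps)
  ultimately have w: "w * v = 1" by simp
  have "w = w * (v * (1 + x))" using v by simp
  also have "\<dots> = 1 + x" using w by (simp flip: mult.assoc)
  finally show ?thesis using v w by (auto simp: is_inverse_of_def)
qed

text \<open>A left ideal above the preimage of \<open>M\<close> has an image that is a left ideal
  above \<open>M\<close>, by surjectivity; injectivity carries the resulting dichotomy back. This is
  what makes the radical stable under automorphisms.\<close>

lemma maximal_left_ideal_vimage: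
  assumes M: "maximal_left_ideal M" and bij: "bij \<phi>"
    and add: "\<And>x y. \<phi> (x + y) = \<phi> x + \<phi> y" and mult: "\<And>x y. \<phi> (x * y) = \<phi> x * \<phi> y"
  shows "maximal_left_ideal (\<phi> -` M)"
proof -
  have zero: "\<phi> 0 = 0" using add[of 0 0] by simp
  have lM: "left_ideal M" using M by (simp add: maximal_left_ideal_def)
  have lv: "left_ideal (\<phi> -` M)" using lM by (auto simp: left_ideal_def add mult zero)
  have "J = \<phi> -` M \<or> J = UNIV" if J: "left_ideal J" and MJ: "\<phi> -` M \<subseteq> J" for J
  proof -
    have "left_ideal (\<phi> ` J)"
      unfolding left_ideal_def
    proof (intro conjI ballI allI)
      show "0 \<in> \<phi> ` J" using left_ideal_zero[OF J] zero by force
      show "x + y \<in> \<phi> ` J" if "x \<in> \<phi> ` J" "y \<in> \<phi> ` J" for x y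
        using that left_ideal_add[OF J] by (auto simp flip: add)
      show "x * y \<in> \<phi> ` J" if "y \<in> \<phi> ` J" for x y
      proof -
        obtain x' where "x = \<phi> x'" using bij by (metis bij_pointE)
        with that left_ideal_mult[OF J] show ?thesis by (auto simp flip: mult)
      qed
    qed
    moreover have "M \<subseteq> \<phi> ` J"
      using image_mono[OF MJ, of \<phi>] bij by (simp add: bij_is_surj surj_image_vimage_eq)
    ultimately have "\<phi> ` J = M \<or> \<phi> ` J = UNIV" using M by (simp add: maximal_left_ideal_def)
    moreover have "\<phi> -` (\<phi> ` J) = J" using bij by (simp add: bij_is_inj inj_vimage_image_eq)
    ultimately show ?thesis by auto
  qed
  moreover have "\<phi> -` M \<noteq> UNIV"
  proof
    assume "\<phi> -` M = UNIV"
    then have "M = UNIV" using bij by (metis bij_is_surj surj_image_vimage_eq)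
    with M show False by (simp add: maximal_left_ideal_def)
  qed
  ultimately show ?thesis using lv by (simp add: maximal_left_ideal_def)
qed

lemma jacobson_radical_image:
  assumes "bij \<phi>"
    and "\<And>x y. \<phi> (x + y) = \<phi> x + \<phi> y" and "\<And>x y. \<phi> (x * y) = \<phi> x * \<phi> y"
    and "x \<in> jacobson_radical"
  shows "\<phi> x \<in> jacobson_radical"
  using maximal_left_ideal_vimage[OF _ assms(1-3)] assms(4) by (auto simp: jacobson_radical_def)

subsection \<open>The grade involution\<close>

lemma algebra_automorphismD:
  assumes "algebra_automorphism scale \<phi>"
  shows "bij \<phi>" and "\<phi> 1 = 1" and "\<phi> (x * y) = \<phi> x * \<phi> y"
    and "\<phi> (x + y) = \<phi> x + \<phi> y" and "\<phi> (scale c x) = scale c (\<phi> x)"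
  using assms unfolding algebra_automorphism_def Vector_Spaces.linear_iff by auto

text \<open>Covers the real and complex cases at once: both metrics are diagonal, over a field in
  which 2 can be inverted.\<close>

locale orthogonal_clifford_algebra = clifford_algebra scale gen n \<eta>
  for scale :: "'f::field \<Rightarrow> 'a::ring_1 \<Rightarrow> 'a" and gen :: "nat \<Rightarrow> 'a" and n :: nat
    and \<eta> :: "nat \<Rightarrow> nat \<Rightarrow> 'f" +
  assumes two_neq_zero: "(2::'f) \<noteq> 0"
    and orthogonal: "\<lbrakk>a \<in> {1..n}; b \<in> {1..n}; a \<noteq> b\<rbrakk> \<Longrightarrow> \<eta> a b = 0"
begin

section \<open>Clifford relations and the basis of blades\<close>

lemma gen_anticommute:
  assumes "a \<in> {1..n}" "b \<in> {1..n}" "a \<noteq> b"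
  shows "gen a * gen b = - (gen b * gen a)"
  using relations[OF assms(1,2)] orthogonal[OF assms] by (simp add: eq_neg_iff_add_eq_0)

lemma gen_square:
  assumes "a \<in> {1..n}"
  shows "gen a * gen a = scale (\<eta> a a) 1"
proof -
  have "scale 2 (gen a * gen a) = gen a * gen a + gen a * gen a"
    using scale_left_distrib[of 1 1 "gen a * gen a"] by simp
  also have "\<dots> = scale 2 (scale (\<eta> a a) 1)"
    using relations[OF assms assms] by simp
  finally show ?thesis using two_neq_zero scale_left_imp_eq by blast
qed

text \<open>Indexing by sets instead of increasing lists turns multiplication by a generator into
  insertion or deletion of one index, up to a scalar.\<close>

definition blade :: "nat set \<Rightarrow> 'a"
  where "blade A = prod_list (map gen (sorted_list_of_set A))"

lemma blade_empty [simp]: "blade {} = 1"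
  by (simp add: blade_def)

text \<open>Peels off the least index, the recursion that matches induction on finite sets by adding
  a new minimum.\<close>

lemma blade_insert_min:
  assumes "finite A" "\<forall>b\<in>A. a < b"
  shows "blade (insert a A) = gen a * blade A"
proof -
  have "a \<notin> A" using assms by auto
  with assms show ?thesis by (auto simp: blade_def insort_is_Cons less_imp_le)
qed

lemma blade_singleton: "blade {a} = gen a"
  using blade_insert_min[of "{}" a] by simp

text \<open>Moving \<open>gen a\<close> rightwards past smaller indices costs only signs, until it
  reaches its place or meets its own copy and squares to a scalar. The scalar, possibly zero, can
  stay unspecified: what matters later is that the index set changes by exactly one element.\<close>

lemma gen_mult_blade:
  assumes a: "a \<in> {1..n}" and A: "A \<subseteq> {1..n}"
  shows "\<exists>c. gen a * blade A = scale c (blade (if a \<in> A then A - {a} else insert a A))"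
proof -
  have "finite A" using A finite_subset by blast
  then show ?thesis using A
  proof (induction A rule: finite_linorder_min_induct)
    case empty
    then show ?case by (auto simp: blade_singleton intro: exI[of _ 1])
  next
    case (insert b A)
    then have b: "b \<in> {1..n}" "b \<notin> A" by auto
    consider "a < b" | "a = b" | "b < a" by linarith
    then show ?case
    proof cases
      case 1
      with insert have min: "\<forall>x\<in>insert b A. a < x" by auto
      then have "a \<notin> insert b A" by blast
      with blade_insert_min[OF _ min] insert show ?thesis by (auto intro: exI[of _ 1])
    next
      case 2
      have "gen b * (gen b * blade A) = scale (\<eta> b b) (blade A)"
        using gen_square b by (simp add: scale_mult_left flip: mult.assoc)
      moreover have "insert b A - {b} = A" using b by auto
      ultimately show ?thesis using 2 insert.hyps by (auto simp: blade_insert_min)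
    next
      case 3
      let ?A = "if a \<in> A then A - {a} else insert a A"
      from insert obtain c where c: "gen a * blade A = scale c (blade ?A)" by auto
      have A: "finite ?A" "\<forall>x\<in>?A. b < x" using insert.hyps 3 by auto
      have "gen a * blade (insert b A) = (gen a * gen b) * blade A"
        using insert.hyps by (simp add: blade_insert_min mult.assoc)
      also have "\<dots> = - (gen b * (gen a * blade A))"
        using gen_anticommute[OF a b(1)] 3 by (simp add: mult.assoc)
      also have "\<dots> = scale (- c) (gen b * blade ?A)" by (simp add: c scale_mult_right)
      also have "gen b * blade ?A = blade (insert b ?A)"
        using A by (simp add: blade_insert_min)
      also have "insert b ?A = (if a \<in> insert b A then insert b A - {a} else insert a (insert b A))"
        using 3 by auto
      finally show ?thesis by blast
    qed
  qed
qed

lemma span_blades: "span (blade ` Pow {1..n}) = UNIV" (is "?V = UNIV")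
proof -
  have gen_V: "gen a * x \<in> ?V" if a: "a \<in> {1..n}" and "x \<in> ?V" for a x
    using \<open>x \<in> ?V\<close>
  proof (induction rule: span_induct_alt)
    case base
    then show ?case by (simp add: span_zero)
  next
    case (step c x y)
    then obtain A where A: "A \<subseteq> {1..n}" "x = blade A" by auto
    let ?A = "if a \<in> A then A - {a} else insert a A"
    obtain d where "gen a * x = scale d (blade ?A)"
      using gen_mult_blade[OF a] A by blast
    moreover have "blade ?A \<in> ?V" using A a by (intro span_base) auto
    ultimately show ?case using step
      by (simp add: distrib_left scale_mult_right span_add span_scale)
  qed
  \<comment> \<open>The elements that map the span into itself by left multiplication form a
    subalgebra containing the generators. Applying them to 1, the empty blade, then yields every
    element.\<close>
  have "{x. \<forall>y\<in>?V. x * y \<in> ?V} = UNIV"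
  proof (rule generated)
    show "subalgebra scale {x. \<forall>y\<in>?V. x * y \<in> ?V}"
      by (auto simp: subalgebra_def subspace_def span_zero distrib_right span_add scale_mult_left
          span_scale mult.assoc)
  qed (use gen_V in auto)
  moreover have "1 \<in> ?V"
    using span_base[OF imageI[of "{}" "Pow {1..n}" blade]] by simp
  ultimately have "x * 1 \<in> ?V" for x by blast
  then show ?thesis by auto
qed

text \<open>There are \<open>2 ^ n\<close> index sets, and a spanning set cannot be smaller than the
  dimension; so no two blades coincide.\<close>

lemma card_blades: "card (blade ` Pow {1..n}) = 2 ^ n"
proof (rule antisym)
  show "card (blade ` Pow {1..n}) \<le> 2 ^ n"
    using card_image_le[of "Pow {1..n}" blade] by (simp add: card_Pow)
  show "2 ^ n \<le> card (blade ` Pow {1..n})"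
    using dim_le_card[of UNIV "blade ` Pow {1..n}"]
    by (simp add: span_blades dimension del: One_nat_def)
qed

lemma inj_on_blade: "inj_on blade (Pow {1..n})"
  using card_blades by (intro eq_card_imp_inj_on) (simp_all add: card_Pow)

text \<open>A blade depending on the others could be dropped, leaving a spanning set of fewer than
  \<open>2 ^ n\<close> elements.\<close>

lemma independent_blades: "independent (blade ` Pow {1..n})" (is "independent ?B")
proof
  assume "dependent ?B"
  then obtain b where b: "b \<in> ?B" "b \<in> span (?B - {b})" by (auto simp: dependent_def)
  then have "span (?B - {b}) = UNIV"
    using span_redundant[OF b(2)] span_blades by (simp add: insert_absorb)
  then have "2 ^ n \<le> card (?B - {b})"
    using dim_le_card[of UNIV "?B - {b}"] by (simp add: dimension del: One_nat_def)
  also have "\<dots> < card ?B" using b(1) by (intro card_Diff1_less) auto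
  finally show False by (simp add: card_blades del: One_nat_def)
qed

section \<open>Uniqueness and existence of the grade involution\<close>

lemma automorphism_eqI:
  assumes "algebra_automorphism scale \<phi>" and "algebra_automorphism scale \<psi>"
    and "\<forall>a\<in>{1..n}. \<phi> (gen a) = \<psi> (gen a)"
  shows "\<phi> = \<psi>"
proof -
  have "\<phi> 0 = 0" "\<psi> 0 = 0"
    using algebra_automorphismD(4)[OF assms(1), of 0 0]
      algebra_automorphismD(4)[OF assms(2), of 0 0] by simp_all
  \<comment> \<open>The set where two automorphisms agree is a subalgebra, so agreement on the
    generators suffices.\<close>
  then have "{x. \<phi> x = \<psi> x} = UNIV"
    using assms(3)
    by (intro generated)
      (auto simp: subalgebra_def subspace_def algebra_automorphismD[OF assms(1)]
        algebra_automorphismD[OF assms(2)])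
  then show ?thesis by auto
qed

text \<open>Signs are prescribed on the basis of blades and extended linearly. Multiplicativity is
  proved first for a generator as left factor, then for all left factors by generation. That the map
  squares to the identity is recorded for the parity splitting.\<close>

lemma grade_involution_exists:
  "\<exists>\<phi>. algebra_automorphism scale \<phi> \<and> (\<forall>a\<in>{1..n}. \<phi> (gen a) = - gen a) \<and> (\<forall>x. \<phi> (\<phi> x) = x)"
proof -
  interpret vector_space_pair scale scale ..
  let ?P = "Pow {1..n}"
  obtain \<phi> where lin: "Vector_Spaces.linear scale scale \<phi>"
    \<comment> \<open>The linear extension takes a function of basis vectors, so the index set is
      recovered from the blade with \<open>inv_into\<close>; injectivity of \<open>blade\<close>
      makes this faithful.\<close>
    and \<phi>B: "\<forall>x\<in>blade ` ?P. \<phi> x = scale ((-1) ^ card (inv_into ?P blade x)) x"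
    using linear_independent_extend[OF independent_blades,
        of "\<lambda>x. scale ((-1) ^ card (inv_into ?P blade x)) x"] by blast
  have \<phi>: "\<phi> (blade A) = scale ((-1) ^ card A) (blade A)" if "A \<subseteq> {1..n}" for A
    using \<phi>B that inv_into_f_f[OF inj_on_blade] by force
  have add: "\<phi> (x + y) = \<phi> x + \<phi> y" and sc: "\<phi> (scale c x) = scale c (\<phi> x)" for x y c
    using lin unfolding Vector_Spaces.linear_iff by auto
  have zero: "\<phi> 0 = 0" using add[of 0 0] by simp
  have one: "\<phi> 1 = 1" using \<phi>[of "{}"] by simp
  have gen: "\<phi> (gen a) = - gen a" if "a \<in> {1..n}" for a
    using \<phi>[of "{a}"] that by (simp add: blade_singleton)
  have gen_mult: "\<phi> (gen a * y) = - gen a * \<phi> y" if a: "a \<in> {1..n}" for a y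
  proof -
    have "y \<in> span (blade ` ?P)" by (simp only: span_blades UNIV_I)
    then show ?thesis
    proof (induction rule: span_induct_alt)
      case base
      show ?case by (simp add: zero)
    next
      case (step c x y)
      then obtain A where A: "A \<subseteq> {1..n}" "x = blade A" by auto
      let ?A = "if a \<in> A then A - {a} else insert a A"
      obtain d where d: "gen a * blade A = scale d (blade ?A)"
        using gen_mult_blade[OF a A(1)] by blast
      have fin: "finite A" using A finite_subset by blast
      \<comment> \<open>Inserting or deleting one index flips the parity of the cardinality, which
        is the sign contributed by \<open>gen a\<close>.\<close>
      have "(-1 :: 'f) ^ card ?A = - ((-1) ^ card A)"
      proof (cases "a \<in> A")
        case True
        then show ?thesis
          using arg_cong[OF card_Suc_Diff1[OF fin True], of "\<lambda>k. - ((-1 :: 'f) ^ k)"] by simp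
      qed (use fin in simp)
      moreover have "?A \<subseteq> {1..n}" using A a by auto
      ultimately have "\<phi> (gen a * x) = - gen a * \<phi> x"
        using A by (simp add: d \<phi> sc scale_mult_right mult.commute)
      with step.IH show ?case by (simp add: add sc distrib_left scale_mult_right)
    qed
  qed
  \<comment> \<open>Quantifying over every right factor \<open>y\<close> makes this set of left
    factors closed under products.\<close>
  have "{x. \<forall>y. \<phi> (x * y) = \<phi> x * \<phi> y} = UNIV"
    by (rule generated)
      (auto simp: subalgebra_def subspace_def zero one add sc distrib_right scale_mult_left
        mult.assoc gen gen_mult)
  then have mult: "\<phi> (x * y) = \<phi> x * \<phi> y" for x y by blast
  have minus: "\<phi> (- x) = - \<phi> x" for x using add[of x "- x"] zero
    by (simp add: eq_neg_iff_add_eq_0 add.commute)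
  have "{x. \<phi> (\<phi> x) = x} = UNIV"
    by (rule generated)
      (auto simp: subalgebra_def subspace_def zero one add sc mult gen minus)
  then have inv: "\<phi> (\<phi> x) = x" for x by blast
  then have "bij \<phi>" by (intro o_bij[of \<phi>]) auto
  with lin one mult gen inv show ?thesis unfolding algebra_automorphism_def by blast
qed

lemma
  shows grade_involution_automorphism: "algebra_automorphism scale (grade_involution scale gen n)"
    and grade_involution_involutive:
      "grade_involution scale gen n (grade_involution scale gen n x) = x"
proof -
  obtain \<phi> where \<phi>: "algebra_automorphism scale \<phi>" "\<forall>a\<in>{1..n}. \<phi> (gen a) = - gen a"
    "\<forall>x. \<phi> (\<phi> x) = x"
    using grade_involution_exists by blast
  then have "grade_involution scale gen n = \<phi>"
    unfolding grade_involution_def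
    by (intro the_equality) (auto intro!: automorphism_eqI)
  with \<phi> show "algebra_automorphism scale (grade_involution scale gen n)"
    "grade_involution scale gen n (grade_involution scale gen n x) = x" by simp_all
qed

end

subsection \<open>Units modulo the radical\<close>

context unital_algebra
begin

lemma scale_one_mult: "scale c 1 * x = scale c x"
  by (simp add: scale_mult_left)

lemma mult_scale_one: "x * scale c 1 = scale c x"
  by (simp add: scale_mult_right)

lemma jacobson_radical_scale: "x \<in> jacobson_radical \<Longrightarrow> scale c x \<in> jacobson_radical"
  using left_ideal_mult[OF left_ideal_jacobson_radical, of x "scale c 1"] by (simp add: scale_one_mult)

lemma scalar_plus_radicalE:
  assumes "W \<in> grade0 scale + jacobson_radical"
  obtains c x where "x \<in> jacobson_radical" and "W = scale c 1 + x"
  using assms by (auto simp: grade0_def elim!: set_plus_elim)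

lemma scalar_plus_radicalI:
  "x \<in> jacobson_radical \<Longrightarrow> scale c 1 + x \<in> grade0 scale + jacobson_radical"
  by (auto simp: grade0_def)

lemma scalar_plus_radical_mult:
  assumes "W \<in> grade0 scale + jacobson_radical" and "W' \<in> grade0 scale + jacobson_radical"
  shows "W * W' \<in> grade0 scale + jacobson_radical"
proof -
  obtain c x where W: "W = scale c 1 + x" "x \<in> jacobson_radical"
    by (rule scalar_plus_radicalE[OF assms(1)])
  obtain c' x' where W': "W' = scale c' 1 + x'" "x' \<in> jacobson_radical"
    by (rule scalar_plus_radicalE[OF assms(2)])
  have "W * W' = scale (c * c') 1 + (x * W' + scale c x')"
    by (simp add: W(1) W'(1) distrib_right distrib_left scale_one_mult)
  moreover have "x * W' + scale c x' \<in> jacobson_radical"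
    by (intro left_ideal_add[OF left_ideal_jacobson_radical] jacobson_radical_mult_right
        jacobson_radical_scale W W')
  ultimately show ?thesis using scalar_plus_radicalI by auto
qed

text \<open>Expanding \<open>W V = 1\<close> gives \<open>c V + x V = 1\<close> with
  \<open>x V\<close> radical. If \<open>c\<close> were 0, then 1 would be radical; so the equation
  can be solved for \<open>V\<close>.\<close>

lemma scalar_plus_radical_inverse:
  assumes "W \<in> grade0 scale + jacobson_radical" and inv: "is_inverse_of V W"
  shows "V \<in> grade0 scale + jacobson_radical"
proof -
  obtain c x where W: "W = scale c 1 + x" "x \<in> jacobson_radical"
    by (rule scalar_plus_radicalE[OF assms(1)])
  have xV: "x * V \<in> jacobson_radical" by (intro jacobson_radical_mult_right W)
  have eq: "scale c V + x * V = 1"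
    using inv by (simp add: is_inverse_of_def W(1) distrib_right scale_one_mult)
  have "c \<noteq> 0"
    using eq xV one_not_in_jacobson_radical by auto
  moreover have "scale c V = 1 + scale (-1) (x * V)" using eq by (simp add: eq_diff_eq)
  ultimately have "V = scale (inverse c) (1 + scale (-1) (x * V))"
    by (metis scale_scale left_inverse scale_one)
  also have "\<dots> = scale (inverse c) 1 + scale (- inverse c) (x * V)"
    by (simp add: scale_right_diff_distrib)
  finally show ?thesis
    using scalar_plus_radicalI jacobson_radical_scale[OF xV] by metis
qed

end

section \<open>Parity and units for an involutive automorphism\<close>

locale involutive_algebra = unital_algebra scale
  for scale :: "'f::field \<Rightarrow> 'a::ring_1 \<Rightarrow> 'a" +
  fixes \<phi> :: "'a \<Rightarrow> 'a"
  assumes automorphism: "algebra_automorphism scale \<phi>"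
    and involutive: "\<phi> (\<phi> x) = x"
    and two_neq_zero: "(2::'f) \<noteq> 0"
begin

lemmas hom = algebra_automorphismD[OF automorphism]

lemma hom_minus: "\<phi> (- x) = - \<phi> x"
  using hom(5)[of "-1" x] by simp

lemma hom_diff: "\<phi> (x - y) = \<phi> x - \<phi> y"
  using hom(4)[of x "- y"] by (simp add: hom_minus)

lemma hom_inverse: "is_inverse_of V U \<Longrightarrow> is_inverse_of (\<phi> V) (\<phi> U)"
  unfolding is_inverse_of_def by (metis hom(2,3))

lemma hom_radical: "x \<in> jacobson_radical \<Longrightarrow> \<phi> x \<in> jacobson_radical"
  using jacobson_radical_image hom by blast

lemma hom_scalar_plus_radical:
  assumes "W \<in> grade0 scale + jacobson_radical"
  shows "\<phi> W \<in> grade0 scale + jacobson_radical"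
  using assms
proof (rule scalar_plus_radicalE)
  fix c x assume "x \<in> jacobson_radical" and "W = scale c 1 + x"
  then show ?thesis by (simp only: hom scalar_plus_radicalI hom_radical)
qed

text \<open>The factorisation \<open>U = T * (1 - T\<^sup>-\<^sup>1 * x)\<close> shows that \<open>U\<close> is a unit, and
  \<open>T = U * (1 + U\<^sup>-\<^sup>1 * x)\<close>.\<close>

lemma invertible_factor_mod_radical:
  assumes inv: "is_inverse_of V T" and T: "T = U + x" and x: "x \<in> jacobson_radical"
  shows "\<exists>V'. is_inverse_of V' U"
    and "\<exists>W\<in>(grade0 scale + jacobson_radical)\<^sup>\<times>. T = U * W"
proof -
  have Vx: "(- V) * x \<in> jacobson_radical"
    using x left_ideal_mult[OF left_ideal_jacobson_radical] by blast
  then obtain v where "is_inverse_of v (1 + (- V) * x)" using jacobson_radical_invertible by blast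
  then have "is_inverse_of (v * V) (T * (1 + (- V) * x))" by (rule is_inverse_of_mult[OF inv])
  moreover have "T * (1 + (- V) * x) = T - T * V * x" by (simp add: right_diff_distrib mult.assoc)
  ultimately have U: "is_inverse_of (v * V) U"
    using inv T by (simp add: is_inverse_of_def)
  then show "\<exists>V'. is_inverse_of V' U" by blast
  let ?x = "(v * V) * x"
  have "?x \<in> jacobson_radical"
    using x left_ideal_mult[OF left_ideal_jacobson_radical] by blast
  then have "1 + ?x \<in> (grade0 scale + jacobson_radical)\<^sup>\<times>"
    using jacobson_radical_invertible[of ?x] scalar_plus_radicalI[of ?x 1]
    by (auto simp: invertibles_def)
  moreover have "U * (1 + ?x) = U + U * (v * V) * x" by (simp add: distrib_left mult.assoc)
  then have "U * (1 + ?x) = T" using U T by (simp add: is_inverse_of_def)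
  ultimately show "\<exists>W\<in>(grade0 scale + jacobson_radical)\<^sup>\<times>. T = U * W" by blast
qed

text \<open>For \<open>T = U W\<close> the homogeneous factor cancels up to sign, and
  \<open>\<phi>\<close> applied to the inverse of \<open>T\<close>, times \<open>T\<close>, becomes
  plus or minus \<open>\<phi> V' * W\<close>. Scalars plus radical are closed under inverses,
  \<open>\<phi>\<close> and products.\<close>

lemma homogeneous_times_scalar_plus_radical:
  assumes U: "\<phi> U = scale ((-1) ^ k) U" and V: "is_inverse_of V U"
    and W: "W \<in> (grade0 scale + jacobson_radical)\<^sup>\<times>"
  shows "U * W \<in> {T \<in> UNIV\<^sup>\<times>. \<phi> (ring_inverse T) * T \<in> (grade0 scale + jacobson_radical)\<^sup>\<times>}"
proof -
  obtain V' where V': "is_inverse_of V' W" and W: "W \<in> grade0 scale + jacobson_radical"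
    using W by (auto simp: invertibles_def)
  have inv: "is_inverse_of (V' * V) (U * W)" by (rule is_inverse_of_mult[OF V V'])
  define s :: 'f where "s = (-1) ^ k"
  have s: "s * s = 1" by (simp add: s_def flip: power_mult_distrib)
  \<comment> \<open>Since \<open>s * s = 1\<close>, both \<open>scale s V\<close> and
    \<open>\<phi> V\<close> invert \<open>\<phi> U\<close>. Uniqueness of inverses gives
    \<open>V\<close> the parity of \<open>U\<close>.\<close>
  have "is_inverse_of (scale s V) (\<phi> U)"
    using V by (simp add: U is_inverse_of_def scale_mult_left scale_mult_right s flip: s_def)
  then have \<phi>V: "\<phi> V = scale s V"
    using ring_inverse_eq[of _ "\<phi> U"] hom_inverse[OF V] by metis
  have "\<phi> (V' * V) * (U * W) = scale s (\<phi> V' * (V * U) * W)"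
    by (simp add: hom \<phi>V scale_mult_left scale_mult_right mult.assoc)
  also have "\<dots> = scale s 1 * (\<phi> V' * W)" using V by (simp add: is_inverse_of_def scale_one_mult)
  also have "\<dots> \<in> grade0 scale + jacobson_radical"
    using scalar_plus_radicalI[OF left_ideal_zero[OF left_ideal_jacobson_radical]]
    by (intro scalar_plus_radical_mult hom_scalar_plus_radical
        scalar_plus_radical_inverse[OF W V'] W) simp
  finally have "\<phi> (V' * V) * (U * W) \<in> grade0 scale + jacobson_radical" .
  moreover have "\<exists>v. is_inverse_of v (\<phi> (V' * V) * (U * W))"
    using is_inverse_of_mult[OF hom_inverse[OF is_inverse_of_sym[OF inv]] inv] by blast
  ultimately show ?thesis using inv by (auto simp: invertibles_def ring_inverse_eq[OF inv])
qed

text \<open>From \<open>T = \<phi> T * (c + x)\<close> with \<open>T = T0 + T1\<close> split by parity, \<open>(1 - c) T0 + (1 + c) T1\<close>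
  is radical, hence so are both summands, and \<open>1 - c\<close> and \<open>1 + c\<close> do not both vanish.\<close>

lemma parity_component_in_radical:
  assumes inv: "is_inverse_of V T"
    and mem: "\<phi> V * T \<in> grade0 scale + jacobson_radical"
  obtains U x k where "k < 2" and "\<phi> U = scale ((-1) ^ k) U" and "T = U + x"
    and "x \<in> jacobson_radical"
proof -
  note add = left_ideal_add[OF left_ideal_jacobson_radical]
  obtain c x where x: "x \<in> jacobson_radical" and cx: "\<phi> V * T = scale c 1 + x"
    by (rule scalar_plus_radicalE[OF mem])
  \<comment> \<open>The even and odd parts of \<open>T\<close>, the projections onto the two
    eigenspaces of \<open>\<phi>\<close>.\<close>
  define T0 where "T0 = scale (inverse 2) (T + \<phi> T)"
  define T1 where "T1 = scale (inverse 2) (T - \<phi> T)"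
  have half: "scale (inverse 2) y + scale (inverse 2) y = y" for y
  proof -
    have "inverse 2 + inverse 2 = (1::'f)" using two_neq_zero by (simp add: field_simps)
    then show ?thesis by (simp flip: scale_left_distrib)
  qed
  have T01: "T = T0 + T1"
    using half[of T] by (simp add: T0_def T1_def scale_right_distrib scale_right_diff_distrib)
  have \<phi>T0: "\<phi> T0 = T0" and \<phi>T1: "\<phi> T1 = - T1"
    by (simp_all add: T0_def T1_def hom hom_diff involutive add.commute flip: scale_minus_right)
  have "T = \<phi> T * (\<phi> V * T)"
    using hom_inverse[OF inv] by (simp add: is_inverse_of_def flip: mult.assoc)
  also have "\<dots> = scale c (T0 - T1) + \<phi> T * x"
    unfolding cx by (simp add: distrib_left mult_scale_one) (simp add: T01 hom \<phi>T0 \<phi>T1)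
  finally have eq: "scale (1 - c) T0 + scale (1 + c) T1 = \<phi> T * x"
    using T01
    by (simp add: scale_left_diff_distrib scale_left_distrib scale_right_diff_distrib algebra_simps)
  then have r: "scale (1 - c) T0 + scale (1 + c) T1 \<in> jacobson_radical"
    using x left_ideal_mult[OF left_ideal_jacobson_radical] by simp
  \<comment> \<open>Applying \<open>\<phi>\<close> keeps the element radical and flips the sign of
    the odd summand; adding and subtracting then isolates twice each summand.\<close>
  from hom_radical[OF this] have r': "scale (1 - c) T0 - scale (1 + c) T1 \<in> jacobson_radical"
    by (simp add: hom \<phi>T0 \<phi>T1)
  have unscale: "d = 0 \<or> y \<in> jacobson_radical" if "scale d y \<in> jacobson_radical" for d y
    using jacobson_radical_scale[OF that, of "inverse d"] by (cases "d = 0") simp_all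
  have halve: "y \<in> jacobson_radical" if "y + y \<in> jacobson_radical" for y :: 'a
    using jacobson_radical_scale[OF that, of "inverse 2"] half[of y]
    by (simp add: scale_right_distrib)
  have "scale (1 - c) T0 \<in> jacobson_radical"
  proof (rule halve)
    have "x + y + (x - y) = x + x" for x y :: 'a by simp
    then show "scale (1 - c) T0 + scale (1 - c) T0 \<in> jacobson_radical"
      using add[OF r r'] by metis
  qed
  then have c0: "c = 1 \<or> T0 \<in> jacobson_radical" using unscale by fastforce
  have "scale (1 + c) T1 \<in> jacobson_radical"
  proof (rule halve)
    have "x + y - (x - y) = y + y" for x y :: 'a by simp
    then show "scale (1 + c) T1 + scale (1 + c) T1 \<in> jacobson_radical"
      using left_ideal_diff[OF left_ideal_jacobson_radical r r'] by metis
  qed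
  then have c1: "c = -1 \<or> T1 \<in> jacobson_radical"
    using unscale by (metis add.commute eq_neg_iff_add_eq_0)
  have "T0 \<in> jacobson_radical \<or> T1 \<in> jacobson_radical"
    using c0 c1 two_neq_zero by (auto simp: eq_neg_iff_add_eq_0)
  then show thesis
    using that[of 0 T0 T1] that[of 1 T1 T0] T01 \<phi>T0 \<phi>T1 by (auto simp: add.commute)
qed

text \<open>The powers with exponents 0 and 1 are left unevaluated so that the sets match
  \<open>parity_subspace\<close> once unfolded.\<close>

theorem homogeneous_units_times_scalar_plus_radical:
  "({U. \<phi> U = scale ((-1) ^ 0) U}\<^sup>\<times> \<union> {U. \<phi> U = scale ((-1) ^ 1) U}\<^sup>\<times>)
      * (grade0 scale + jacobson_radical)\<^sup>\<times>
    = {T \<in> UNIV\<^sup>\<times>. \<phi> (ring_inverse T) * T \<in> (grade0 scale + jacobson_radical)\<^sup>\<times>}"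
  (is "(?H 0 \<union> ?H 1) * ?S = ?R")
proof
  show "(?H 0 \<union> ?H 1) * ?S \<subseteq> ?R"
  proof
    fix T assume "T \<in> (?H 0 \<union> ?H 1) * ?S"
    then obtain U W where T: "T = U * W" and U: "U \<in> ?H 0 \<union> ?H 1" and W: "W \<in> ?S"
      by (rule set_times_elim)
    from U obtain k V where "\<phi> U = scale ((-1) ^ k) U" "is_inverse_of V U"
      unfolding invertibles_def by blast
    with W show "T \<in> ?R" unfolding T by (intro homogeneous_times_scalar_plus_radical)
  qed
  show "?R \<subseteq> (?H 0 \<union> ?H 1) * ?S"
  proof
    fix T assume "T \<in> ?R"
    then obtain V where V: "is_inverse_of V T"
      and mem: "\<phi> (ring_inverse T) * T \<in> grade0 scale + jacobson_radical"
      by (auto simp: invertibles_def)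
    then have "\<phi> V * T \<in> grade0 scale + jacobson_radical" by (simp add: ring_inverse_eq)
    then obtain U x and k :: nat where k: "k < 2" and U: "\<phi> U = scale ((-1) ^ k) U"
      and T: "T = U + x" and x: "x \<in> jacobson_radical"
      by (rule parity_component_in_radical[OF V])
    from invertible_factor_mod_radical[OF V T x] U
    obtain W where "U \<in> ?H k" "W \<in> ?S" "T = U * W" by (auto simp: invertibles_def)
    moreover have "k = 0 \<or> k = 1" using k by auto
    ultimately show "T \<in> (?H 0 \<union> ?H 1) * ?S" by blast
  qed
qed

end

section \<open>Specialisation to real and complex geometric algebras\<close>

context orthogonal_clifford_algebra
begin

theorem P_pm_rad_eq:
  "P_pm_rad scale gen n =
      {T \<in> UNIV\<^sup>\<times>. grade_involution scale gen n (ring_inverse T) * T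
        \<in> (grade0 scale + jacobson_radical)\<^sup>\<times>}"
proof -
  interpret involutive_algebra scale "grade_involution scale gen n"
    by unfold_locales
      (rule grade_involution_automorphism grade_involution_involutive two_neq_zero)+
  show ?thesis
    unfolding P_pm_rad_def P_pm_def parity_subspace_def
    by (rule homogeneous_units_times_scalar_plus_radical)
qed

end

theorem theorem4p6:
  fixes p q r n :: nat
    and smultR :: "real \<Rightarrow> 'a::ring_1 \<Rightarrow> 'a" and genR :: "nat \<Rightarrow> 'a"
    and smultC :: "complex \<Rightarrow> 'b::ring_1 \<Rightarrow> 'b" and genC :: "nat \<Rightarrow> 'b"
  assumes "n = p + q + r" and "n \<ge> 1"
  shows "(real_geometric_algebra p q r smultR genR \<longrightarrow>
      P_pm_rad smultR genR n =
        ((parity_subspace smultR genR n 0)\<^sup>\<times> \<union> (parity_subspace smultR genR n 1)\<^sup>\<times>)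
          * (grade0 smultR + jacobson_radical)\<^sup>\<times>
      \<and> ((parity_subspace smultR genR n 0)\<^sup>\<times> \<union> (parity_subspace smultR genR n 1)\<^sup>\<times>)
          * (grade0 smultR + jacobson_radical)\<^sup>\<times>
        = {T \<in> UNIV\<^sup>\<times>. grade_involution smultR genR n (ring_inverse T) * T
            \<in> (grade0 smultR + jacobson_radical)\<^sup>\<times>})
    \<and> (complex_geometric_algebra p q r smultC genC \<longrightarrow>
      P_pm_rad smultC genC n =
        ((parity_subspace smultC genC n 0)\<^sup>\<times> \<union> (parity_subspace smultC genC n 1)\<^sup>\<times>)
          * (grade0 smultC + jacobson_radical)\<^sup>\<times>
      \<and> ((parity_subspace smultC genC n 0)\<^sup>\<times> \<union> (parity_subspace smultC genC n 1)\<^sup>\<times>)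
          * (grade0 smultC + jacobson_radical)\<^sup>\<times>
        = {T \<in> UNIV\<^sup>\<times>. grade_involution smultC genC n (ring_inverse T) * T
            \<in> (grade0 smultC + jacobson_radical)\<^sup>\<times>})"
proof -
  have real: "orthogonal_clifford_algebra smultR genR n (real_metric p q)"
    if "real_geometric_algebra p q r smultR genR"
    using that assms(1)
    by (auto simp: real_geometric_algebra_def real_metric_def orthogonal_clifford_algebra_def
        orthogonal_clifford_algebra_axioms_def)
  have complex: "orthogonal_clifford_algebra smultC genC n (complex_metric p q)"
    if "complex_geometric_algebra p q r smultC genC"
    using that assms(1)
    by (auto simp: complex_geometric_algebra_def complex_metric_def orthogonal_clifford_algebra_def
        orthogonal_clifford_algebra_axioms_def)
  show ?thesis
    \<comment> \<open>The first equality in each case is the definition of \<open>P_pm_rad\<close>;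
      the second is the characterisation just proved.\<close>
    using orthogonal_clifford_algebra.P_pm_rad_eq[OF real]
      orthogonal_clifford_algebra.P_pm_rad_eq[OF complex]
    by (simp add: P_pm_rad_def P_pm_def)
qed

end
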